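(* For $n\ge 2$, let $USp(2n)$ be endowed with its standard bi-invariant Riemannian metric and let $\mu_n$ be its normalised invariant (Haar) measure. Let $B_n=S^{4n-1}\equiv USp(2n)/USp(2n-2)$, so that $USp(2n)$ is a $USp(2n-2)$-fibration $\pi_n:USp(2n)\to B_n$. Let $S_n$ be an equator of $B_n$, with embedding $\iota:S_n\hookrightarrow B_n$, and let $\Sigma_n=\iota^*(USp(2n))=\pi_n^{-1}(S_n)\subset USp(2n)$, a subvariety of codimension one. Then the measure $\mu_n$ concentrates on $\Sigma_n$: there is a sequence $\varepsilon_n>0$ with $\lim_{n\to\infty}\varepsilon_n=0$ such that, denoting by $U_n^{\varepsilon_n}$ the tubular neighbourhood of $\Sigma_n$ of radius $\varepsilon_n$ in $USp(2n)$, $$\lim_{n\to\infty}\mu_n\big(USp(2n)\setminus U_n^{\varepsilon_n}\big)=0 .$$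
   Context: $USp(2n)$ is the compact symplectic group, realised as the unitary $2n\times 2n$ complex matrices $g$ with $g^{t}Jg=J$, $J=\begin{pmatrix}0&I_n\\-I_n&0\end{pmatrix}$. It acts transitively on the unit sphere $S^{4n-1}\subset\mathbb C^{2n}$, and the stabiliser of the first canonical basis vector $e_1$ is a copy of $USp(2n-2)$; the projection is $\pi_n(g)=g e_1$. The standard bi-invariant metric on $USp(2n)$ is the bi-invariant Riemannian metric whose value at the identity is $\langle X,Y\rangle=-\tfrac12\mathrm{Tr}(XY)$ (trace of $2n\times2n$ matrices). An equator of $S^{4n-1}\subset\mathbb C^{2n}\cong\mathbb R^{4n}$ is the intersection of the sphere with a real hyperplane through the origin. The tubular neighbourhood of radius $\varepsilon$ of a closed subset is the set of points at Riemannian distance less than $\varepsilon$ from it. *)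

theory Defs
  imports "HOL-Probability.Probability_Measure" "Jordan_Normal_Form.Schur_Decomposition"
begin

unbundle no vec_syntax
unbundle no inner_syntax

text \<open>Throughout, \<open>n\<close> is the quaternionic rank: \<open>USp n\<close> is the group \<open>USp(2n)\<close> of
  \<open>2n \<times> 2n\<close> matrices and \<open>sphere_C n\<close> is \<open>S\<^sup>4\<^sup>n\<^sup>-\<^sup>1\<close> in \<open>\<complex>\<^sup>2\<^sup>n\<close>. The dimension is a natural
  number rather than a type, since the result is about the limit in \<open>n\<close>.\<close>

definition J_mat :: "nat \<Rightarrow> complex mat" where
  "J_mat n = four_block_mat (0\<^sub>m n n) (1\<^sub>m n) (- 1\<^sub>m n) (0\<^sub>m n n)"

definition USp :: "nat \<Rightarrow> complex mat set" where
  "USp n = {g \<in> carrier_mat (2*n) (2*n).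
     mat_adjoint g * g = 1\<^sub>m (2*n) \<and> transpose_mat g * J_mat n * g = J_mat n}"

definition mat_trace :: "complex mat \<Rightarrow> complex" where
  "mat_trace A = (\<Sum>i<dim_row A. A $$ (i, i))"

text \<open>On the Lie algebra the trace of a product of two (anti-Hermitian) matrices is real, so
  the real part below only adjusts the type.\<close>

definition lie_inner :: "complex mat \<Rightarrow> complex mat \<Rightarrow> real" where
  "lie_inner X Y = - (1/2) * Re (mat_trace (X * Y))"

text \<open>The Riemannian metric at \<open>g\<close>: tangent vectors at \<open>g\<close>, given as matrices, are
  translated to the identity by the inverse of \<open>g\<close>, which is its adjoint.\<close>

definition USp_metric :: "complex mat \<Rightarrow> complex mat \<Rightarrow> complex mat \<Rightarrow> real" where
  "USp_metric g A B = lie_inner (mat_adjoint g * A) (mat_adjoint g * B)"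

definition mat_velocity :: "nat \<Rightarrow> (real \<Rightarrow> complex mat) \<Rightarrow> real \<Rightarrow> complex mat" where
  "mat_velocity n c t =
     mat (2*n) (2*n) (\<lambda>(i, j). vector_derivative (\<lambda>s. c s $$ (i, j)) (at t))"

definition USp_curves :: "nat \<Rightarrow> complex mat \<Rightarrow> complex mat \<Rightarrow> (real \<Rightarrow> complex mat) set" where
  "USp_curves n g h = {c. (\<forall>t\<in>{0..1}. c t \<in> USp n) \<and> c 0 = g \<and> c 1 = h \<and>
     (\<forall>i<2*n. \<forall>j<2*n. (\<lambda>t. c t $$ (i, j)) piecewise_C1_differentiable_on {0..1})}"

text \<open>The library's piecewise \<open>C\<^sup>1\<close> curves may have an unbounded derivative near the
  exceptional points. The length is therefore a nonnegative Lebesgue integral, which is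
  infinite for a non-rectifiable curve; a real-valued integral would be the default 0 there
  and would collapse the distance.\<close>

definition USp_length :: "nat \<Rightarrow> (real \<Rightarrow> complex mat) \<Rightarrow> ennreal" where
  "USp_length n c =
     (\<integral>\<^sup>+ t \<in> {0..1}. ennreal (sqrt (USp_metric (c t) (mat_velocity n c t) (mat_velocity n c t)))
        \<partial>lborel)"

definition USp_dist :: "nat \<Rightarrow> complex mat \<Rightarrow> complex mat \<Rightarrow> ennreal" where
  "USp_dist n g h = (INF c \<in> USp_curves n g h. USp_length n c)"

definition tubular_nbhd :: "nat \<Rightarrow> complex mat set \<Rightarrow> real \<Rightarrow> complex mat set" where
  "tubular_nbhd n A r = {g \<in> USp n. (INF h \<in> A. USp_dist n g h) < ennreal r}"

text \<open>Matrices carry no topology in the library. Extending the entries by 0 embeds the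
  \<open>2n \<times> 2n\<close> matrices homeomorphically into a function space with the product topology, so the
  pullback of its Borel sets is the usual Borel \<open>\<sigma>\<close>-algebra of \<open>USp n\<close>.\<close>

definition mat_entries :: "complex mat \<Rightarrow> nat \<Rightarrow> nat \<Rightarrow> complex" where
  "mat_entries A = (\<lambda>i j. if i < dim_row A \<and> j < dim_col A then A $$ (i, j) else 0)"

definition USp_borel :: "nat \<Rightarrow> complex mat measure" where
  "USp_borel n = vimage_algebra (USp n) mat_entries borel"

text \<open>The normalised Haar measure is characterised by left invariance; by compactness it is
  then unique and also right invariant.\<close>

definition is_haar_measure :: "nat \<Rightarrow> complex mat measure \<Rightarrow> bool" where
  "is_haar_measure n M \<longleftrightarrow> space M = USp n \<and> sets M = sets (USp_borel n) \<and> prob_space M \<and>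
     (\<forall>g \<in> USp n. \<forall>A \<in> sets M. emeasure M ((\<lambda>h. g * h) ` A) = emeasure M A)"

definition sphere_C :: "nat \<Rightarrow> complex Matrix.vec set" where
  "sphere_C n = {x \<in> carrier_vec (2*n). x \<bullet>c x = 1}"

definition USp_proj :: "nat \<Rightarrow> complex mat \<Rightarrow> complex Matrix.vec" where
  "USp_proj n g = g *\<^sub>v unit_vec (2*n) 0"

text \<open>\<open>Re (x \<bullet>c v)\<close> is the Euclidean inner product of \<open>\<complex>\<^sup>2\<^sup>n = \<real>\<^sup>4\<^sup>n\<close>.\<close>

definition is_equator :: "nat \<Rightarrow> complex Matrix.vec set \<Rightarrow> bool" where
  "is_equator n S \<longleftrightarrow>
     (\<exists>v \<in> carrier_vec (2*n). v \<noteq> 0\<^sub>v (2*n) \<and> S = {x \<in> sphere_C n. Re (x \<bullet>c v) = 0})"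

definition equator_preimage :: "nat \<Rightarrow> complex Matrix.vec set \<Rightarrow> complex mat set" where
  "equator_preimage n S = {g \<in> USp n. USp_proj n g \<in> S}"

end

theory Submission
  imports Defs
begin

text \<open>The height of a point of the sphere over an equator is its real inner product with a unit normal
  vector \<open>v\<close>. On a sphere of large dimension this height is typically of order \<open>n ^ (- 1/2)\<close>, so
  almost all of the group maps \<open>e\<^sub>1\<close> close to the equator. Two facts make this precise without the
  isoperimetric inequality.

  The first is a variance bound. The distribution of a column of a Haar-random matrix is invariant
  under left multiplication by the group, in particular under transpositions and sign changes of the
  \<open>n\<close> quaternionic coordinates. Sign changes make the contributions of different coordinates to the
  height uncorrelated, and transpositions give every coordinate the mean squared length \<open>1 / n\<close>, so the
  mean square of the height is at most \<open>1 / n\<close> (\<open>second_moment_le\<close>). By the same bound and Markov's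
  inequality, \<open>v\<close> has a projection of squared norm at least \<open>t\<close> onto the quaternionic line of \<open>g e\<^sub>1\<close>
  with probability at most \<open>4 / (n t)\<close> (\<open>col_herm_tail\<close>).

  The second is that a small height is removed by a short path in the group, not only in the sphere
  (\<open>rotate_into_equator\<close>). If the projection of \<open>v\<close> onto the quaternionic line of \<open>g e\<^sub>1\<close> is small, most
  of \<open>v\<close> is orthogonal to this line over the quaternions, and \<open>g e\<^sub>1\<close> can be rotated towards that part
  of \<open>v\<close>. This rotation of a quaternionic plane is a one-parameter subgroup whose generator \<open>X\<close> has rank
  four and satisfies \<open>X\<^sup>3 = - X\<close>. Its speed is therefore \<open>sqrt 2\<close>, independent of \<open>n\<close>, and the path to
  the preimage of the equator has length at most twice the height. Multiplying by a unit quaternion in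
  all coordinates at once would also move \<open>g e\<^sub>1\<close>, but at a speed that grows with \<open>n\<close>.

  With heights up to \<open>\<delta>\<close> allowed, the complement of the tube of radius \<open>3 \<delta>\<close> has measure at most
  \<open>4 / (n \<delta>\<^sup>2)\<close>, and \<open>\<delta> = n ^ (- 1/4)\<close> makes both quantities tend to \<open>0\<close>.\<close>

section \<open>Matrices of the symplectic group\<close>

lemma index_mult_mat_sum:
  assumes "A \<in> carrier_mat m k" "B \<in> carrier_mat k l" "i < m" "j < l"
  shows "(A * B) $$ (i, j) = (\<Sum>r<k. A $$ (i, r) * B $$ (r, j))"
  using assms by (auto simp: scalar_prod_def lessThan_atLeast0)

lemma index_mat_adjoint:
  fixes A :: "complex mat"
  assumes "i < dim_col A" "j < dim_row A"
  shows "mat_adjoint A $$ (i, j) = cnj (A $$ (j, i))"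
  using assms by (simp add: mat_adjoint_def mat_of_rows_index)

lemma dim_mat_adjoint [simp]:
  "dim_row (mat_adjoint A) = dim_col A" "dim_col (mat_adjoint A) = dim_row A"
  by (simp_all add: mat_adjoint_def)

lemma mat_adjoint_carrier:
  "A \<in> carrier_mat m k \<Longrightarrow> mat_adjoint A \<in> carrier_mat k m"
  by (intro carrier_matI) auto

lemma mat_adjoint_mult:
  fixes A B :: "complex mat"
  assumes "A \<in> carrier_mat m k" "B \<in> carrier_mat k l"
  shows "mat_adjoint (A * B) = mat_adjoint B * mat_adjoint A"
proof (rule eq_matI)
  fix i j assume "i < dim_row (mat_adjoint B * mat_adjoint A)" "j < dim_col (mat_adjoint B * mat_adjoint A)"
  then have ij: "i < l" "j < m" using assms by auto
  have "mat_adjoint (A * B) $$ (i, j) = cnj ((A * B) $$ (j, i))"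
    using ij assms by (subst index_mat_adjoint) auto
  also have "\<dots> = (\<Sum>r<k. mat_adjoint B $$ (i, r) * mat_adjoint A $$ (r, j))"
    using ij assms by (simp add: index_mult_mat_sum[OF assms] index_mat_adjoint mult.commute
        del: index_mult_mat)
  also have "\<dots> = (mat_adjoint B * mat_adjoint A) $$ (i, j)"
    using ij assms
    by (simp add: index_mult_mat_sum[of _ l k _ m] mat_adjoint_carrier del: index_mult_mat)
  finally show "mat_adjoint (A * B) $$ (i, j) = (mat_adjoint B * mat_adjoint A) $$ (i, j)" .
qed (use assms in auto)

lemma J_mat_carrier [simp]: "J_mat n \<in> carrier_mat (2*n) (2*n)"
  by (simp add: J_mat_def mult_2)

lemma dim_J_mat [simp]: "dim_row (J_mat n) = 2*n" "dim_col (J_mat n) = 2*n"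
  using carrier_matD[OF J_mat_carrier[of n]] by auto

lemma index_J_mat:
  assumes "i < 2*n" "j < 2*n"
  shows "J_mat n $$ (i, j) = (if j = i + n then 1 else if i = j + n then - 1 else 0)"
  using assms by (auto simp: J_mat_def)

text \<open>The blocks of \<open>J\<close> exchange the two halves of a vector and negate one of them. Sums
  against a row of \<open>J\<close> occur both in the symplectic condition for the generator of a rotation
  and in the one for signed permutations.\<close>

lemma sum_J_mat:
  assumes "i < 2*n"
  shows "(\<Sum>k<2*n. J_mat n $$ (i, k) * z k) = (if i < n then z (i + n) else - z (i - n))"
proof (cases "i < n")
  case True
  have "(\<Sum>k<2*n. J_mat n $$ (i, k) * z k) = (\<Sum>k<2*n. if k = i + n then z k else 0)"
    using True assms by (intro sum.cong) (auto simp: index_J_mat)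
  then show ?thesis using True by simp
next
  case False
  have "(\<Sum>k<2*n. J_mat n $$ (i, k) * z k) = (\<Sum>k<2*n. if k = i - n then - z k else 0)"
    using False assms by (intro sum.cong) (auto simp: index_J_mat)
  then show ?thesis using False assms by simp
qed

lemma J_mat_skew: "transpose_mat (J_mat n) = - J_mat n"
  by (rule eq_matI) (auto simp: index_J_mat)

lemma USpD:
  assumes "g \<in> USp n"
  shows "g \<in> carrier_mat (2*n) (2*n)" "mat_adjoint g * g = 1\<^sub>m (2*n)"
    "transpose_mat g * J_mat n * g = J_mat n"
  using assms by (simp_all add: USp_def)

lemmas USp_carrier = USpD(1)

lemma mult_mult_mult_mat:
  assumes "A \<in> carrier_mat m m" "B \<in> carrier_mat m m" "C \<in> carrier_mat m m" "D \<in> carrier_mat m m"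
  shows "(A * B) * (C * D) = A * (B * C) * D"
  using assoc_mult_mat[OF assms(1,2) mult_carrier_mat[OF assms(3,4)]]
    assoc_mult_mat[OF assms(2-4)] assoc_mult_mat[OF assms(1) mult_carrier_mat[OF assms(2,3)] assms(4)]
  by (simp del: assoc_mult_mat)

lemma USp_mult:
  assumes g: "g \<in> USp n" and h: "h \<in> USp n"
  shows "g * h \<in> USp n"
proof -
  note gc = USpD(1)[OF g] and hc = USpD(1)[OF h]
  have c: "transpose_mat g \<in> carrier_mat (2*n) (2*n)" "transpose_mat h \<in> carrier_mat (2*n) (2*n)"
    using gc hc by auto
  note ac = mat_adjoint_carrier[OF gc] mat_adjoint_carrier[OF hc]
  have "mat_adjoint (g * h) * (g * h) = mat_adjoint h * (mat_adjoint g * g) * h"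
    unfolding mat_adjoint_mult[OF gc hc] using mult_mult_mult_mat[OF ac(2,1) gc hc] .
  then have 1: "mat_adjoint (g * h) * (g * h) = 1\<^sub>m (2*n)"
    using USpD(2)[OF h] unfolding USpD(2)[OF g] right_mult_one_mat[OF ac(2)] by (rule trans)
  have "transpose_mat (g * h) * J_mat n = transpose_mat h * (transpose_mat g * J_mat n)"
    unfolding transpose_mult[OF gc hc] by (rule assoc_mult_mat[OF c(2,1) J_mat_carrier])
  then have "transpose_mat (g * h) * J_mat n * (g * h) = transpose_mat h * (transpose_mat g * J_mat n * g) * h"
    using mult_mult_mult_mat[OF c(2) mult_carrier_mat[OF c(1) J_mat_carrier] gc hc] by simp
  then have 2: "transpose_mat (g * h) * J_mat n * (g * h) = J_mat n"
    using USpD(3)[OF h] unfolding USpD(3)[OF g] by (rule trans)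
  show ?thesis using 1 2 mult_carrier_mat[OF gc hc] by (simp add: USp_def)
qed

section \<open>Rotations of a quaternionic plane\<close>

definition herm :: "nat \<Rightarrow> (nat \<Rightarrow> complex) \<Rightarrow> (nat \<Rightarrow> complex) \<Rightarrow> complex" where
  "herm m x y = (\<Sum>i<m. x i * cnj (y i))"

lemma herm_cnj: "cnj (herm m x y) = herm m y x"
  by (simp add: herm_def mult.commute)

lemma sum_two_blocks:
  fixes n :: nat
  shows "(\<Sum>i<2*n. f i) = (\<Sum>i<n. f i + f (i + n))"
proof -
  have split: "{..<2*n} = {..<n} \<union> {n..<n+n}" by auto
  have "(\<Sum>i<2*n. f i) = (\<Sum>i<n. f i) + (\<Sum>i\<in>{n..<n+n}. f i)"
    unfolding split by (rule sum.union_disjoint) auto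
  also have "(\<Sum>i\<in>{n..<n+n}. f i) = (\<Sum>i<n. f (i + n))"
    using sum.shift_bounds_nat_ivl[of f 0 n n] by (simp add: lessThan_atLeast0)
  finally show ?thesis by (simp add: sum.distrib)
qed

text \<open>This is \<open>x \<mapsto> J cnj(x)\<close>, the multiplication by the quaternion \<open>j\<close> when \<open>\<complex>\<^sup>2\<^sup>n\<close> is read as a
  quaternionic space; the quaternionic line of \<open>x\<close> is the complex span of \<open>x\<close> and \<open>qconj n x\<close>. Vectors are
  functions here, of which only the values at indices below \<open>2n\<close> matter; this avoids carrier
  conditions.\<close>

definition qconj :: "nat \<Rightarrow> (nat \<Rightarrow> complex) \<Rightarrow> nat \<Rightarrow> complex" where
  "qconj n x i = (if i < n then cnj (x (i + n)) else - cnj (x (i - n)))"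

text \<open>The bilinear form with matrix \<open>J\<close> is alternating. For \<open>y = x\<close> this makes a vector
  orthogonal to its \<open>j\<close>-multiple.\<close>

lemma herm_qconj_swap: "herm (2*n) (qconj n x) y = - herm (2*n) (qconj n y) x"
  unfolding herm_def sum_two_blocks
  by (simp add: qconj_def sum_negf[symmetric] algebra_simps)

lemma herm_qconj_self: "herm (2*n) (qconj n x) x = 0"
  using herm_qconj_swap[of n x x] by simp

lemma herm_qconj_qconj: "herm (2*n) (qconj n x) (qconj n y) = herm (2*n) y x"
  unfolding herm_def sum_two_blocks
  by (simp add: qconj_def algebra_simps)

text \<open>Writing \<open>j\<close> for \<open>qconj n\<close>, this is the matrix
  \<open>u e\<^sup>* - e u\<^sup>* + (j u) (j e)\<^sup>* - (j e) (j u)\<^sup>*\<close>. The first two terms generate the rotation from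
  \<open>e\<close> towards \<open>u\<close>; the last two do the same for the \<open>j\<close>-multiples, which makes the matrix commute
  with \<open>j\<close>. A skew-Hermitian matrix that commutes with \<open>j\<close> lies in the symplectic Lie algebra.\<close>

definition rot_gen :: "nat \<Rightarrow> (nat \<Rightarrow> complex) \<Rightarrow> (nat \<Rightarrow> complex) \<Rightarrow> complex mat" where
  "rot_gen n e u = mat (2*n) (2*n) (\<lambda>(i, j).
     u i * cnj (e j) - e i * cnj (u j) + qconj n u i * cnj (qconj n e j) - qconj n e i * cnj (qconj n u j))"

text \<open>The exponential of \<open>t X\<close> for a generator with \<open>X\<^sup>3 = - X\<close>, summed in closed form: odd powers
  of \<open>X\<close> collect to \<open>sin t\<close>, positive even ones to \<open>1 - cos t\<close>.\<close>

definition rot :: "nat \<Rightarrow> (nat \<Rightarrow> complex) \<Rightarrow> (nat \<Rightarrow> complex) \<Rightarrow> real \<Rightarrow> complex mat" where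
  "rot n e u t = 1\<^sub>m (2*n) + complex_of_real (sin t) \<cdot>\<^sub>m rot_gen n e u
     + complex_of_real (1 - cos t) \<cdot>\<^sub>m (rot_gen n e u * rot_gen n e u)"

text \<open>The hypotheses say that \<open>e\<close> and \<open>u\<close> are orthonormal over the quaternions. Consequently
  \<open>e, u, j e, j u\<close> are orthonormal over the complex numbers, which is all that the computations with
  the generator use.\<close>

locale quat_frame =
  fixes n :: nat and e u :: "nat \<Rightarrow> complex"
  assumes e_e: "herm (2*n) e e = 1" and u_u: "herm (2*n) u u = 1"
    and u_e: "herm (2*n) u e = 0" and ju_e: "herm (2*n) (qconj n u) e = 0"
begin

abbreviation "je \<equiv> qconj n e"
abbreviation "ju \<equiv> qconj n u"
abbreviation "X \<equiv> rot_gen n e u"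

lemma frame_products:
  "herm (2*n) je je = 1" "herm (2*n) ju ju = 1" "herm (2*n) e u = 0"
  "herm (2*n) e je = 0" "herm (2*n) je e = 0" "herm (2*n) u ju = 0" "herm (2*n) ju u = 0"
  "herm (2*n) e ju = 0" "herm (2*n) u je = 0" "herm (2*n) je u = 0"
  "herm (2*n) je ju = 0" "herm (2*n) ju je = 0"
proof -
  show "herm (2*n) je je = 1" "herm (2*n) ju ju = 1"
    using e_e u_u by (simp_all add: herm_qconj_qconj)
  show 1: "herm (2*n) e u = 0" using u_e herm_cnj[of "2*n" u e] by simp
  show "herm (2*n) je ju = 0" "herm (2*n) ju je = 0" using 1 u_e by (simp_all add: herm_qconj_qconj)
  show "herm (2*n) je e = 0" "herm (2*n) ju u = 0" by (simp_all add: herm_qconj_self)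
  then show "herm (2*n) e je = 0" "herm (2*n) u ju = 0"
    using herm_cnj[of "2*n" je e] herm_cnj[of "2*n" ju u] by simp_all
  show 2: "herm (2*n) je u = 0" using ju_e herm_qconj_swap[of n e u] by simp
  then show "herm (2*n) u je = 0" using herm_cnj[of "2*n" je u] by simp
  show "herm (2*n) e ju = 0" using ju_e herm_cnj[of "2*n" ju e] by simp
qed

lemma X_carrier [simp]: "X \<in> carrier_mat (2*n) (2*n)"
  by (simp add: rot_gen_def)

lemma X_apply:
  assumes "i < 2*n"
  shows "(\<Sum>k<2*n. X $$ (i, k) * z k) = u i * herm (2*n) z e - e i * herm (2*n) z u
    + ju i * herm (2*n) z je - je i * herm (2*n) z ju"
  unfolding herm_def using assms
  by (simp add: rot_gen_def sum_distrib_left sum.distrib sum_subtractf algebra_simps)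

text \<open>On the span of the frame \<open>X\<close> is a rotation by a right angle, \<open>e \<mapsto> u \<mapsto> - e\<close> and
  \<open>j e \<mapsto> j u \<mapsto> - j e\<close>. The columns of \<open>X\<close> and of \<open>X\<^sup>2\<close> are such combinations, so this computes
  all powers of \<open>X\<close>.\<close>

lemma X_apply_comb:
  assumes "i < 2*n"
  shows "(\<Sum>k<2*n. X $$ (i, k) * (a * e k + b * u k + c * je k + d * ju k)) =
    a * u i - b * e i + c * ju i - d * je i"
proof -
  have lin: "herm (2*n) (\<lambda>k. a * e k + b * u k + c * je k + d * ju k) y =
      a * herm (2*n) e y + b * herm (2*n) u y + c * herm (2*n) je y + d * herm (2*n) ju y" for y
    unfolding herm_def by (simp add: sum_distrib_left sum.distrib algebra_simps)
  show ?thesis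
    unfolding X_apply[OF assms] lin by (simp add: frame_products e_e u_u u_e ju_e)
qed

text \<open>\<open>- X\<^sup>2\<close> is the orthogonal projection onto the span of the frame.\<close>

lemma X_square:
  "X * X = mat (2*n) (2*n) (\<lambda>(i, j).
     - e i * cnj (e j) - u i * cnj (u j) - je i * cnj (je j) - ju i * cnj (ju j))" (is "_ = ?R")
proof (rule eq_matI)
  fix i j assume "i < dim_row ?R" "j < dim_col ?R"
  then have ij: "i < 2*n" "j < 2*n" by auto
  have "(X * X) $$ (i, j) = (\<Sum>k<2*n. X $$ (i, k) * X $$ (k, j))"
    using ij by (simp add: index_mult_mat_sum[of _ "2*n" "2*n" _ "2*n"] del: index_mult_mat)
  also have "\<dots> = (\<Sum>k<2*n. X $$ (i, k) *
      (- cnj (u j) * e k + cnj (e j) * u k + (- cnj (ju j)) * je k + cnj (je j) * ju k))"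
    using ij by (intro sum.cong refl arg_cong2[where f = "(*)"]) (simp add: rot_gen_def algebra_simps)
  also have "\<dots> = ?R $$ (i, j)"
    using ij unfolding X_apply_comb[OF ij(1)] by (simp add: algebra_simps)
  finally show "(X * X) $$ (i, j) = ?R $$ (i, j)" .
qed (auto simp: rot_gen_def)

lemma X_cube: "X * (X * X) = - X"
proof (rule eq_matI)
  fix i j assume "i < dim_row (- X)" "j < dim_col (- X)"
  then have ij: "i < 2*n" "j < 2*n" by (auto simp: rot_gen_def)
  have "(X * (X * X)) $$ (i, j) = (\<Sum>k<2*n. X $$ (i, k) * (X * X) $$ (k, j))"
    using ij by (simp add: index_mult_mat_sum[of _ "2*n" "2*n" _ "2*n"] mult_carrier_mat[of _ _ "2*n"] del: index_mult_mat)
  also have "\<dots> = (\<Sum>k<2*n. X $$ (i, k) *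
      (- cnj (e j) * e k + - cnj (u j) * u k + (- cnj (je j)) * je k + - cnj (ju j) * ju k))"
    using ij by (intro sum.cong refl arg_cong2[where f = "(*)"]) (simp add: X_square algebra_simps)
  also have "\<dots> = (- X) $$ (i, j)"
    using ij unfolding X_apply_comb[OF ij(1)] by (simp add: rot_gen_def algebra_simps)
  finally show "(X * (X * X)) $$ (i, j) = (- X) $$ (i, j)" .
qed (auto simp: rot_gen_def)

text \<open>Since \<open>J\<close> is skew, the claim is that \<open>J X\<close> is symmetric. Its entries show this, because
  \<open>J\<close> sends \<open>u\<close> and \<open>e\<close> to the conjugates of \<open>j u\<close> and \<open>j e\<close>, and those back to the negative
  conjugates of \<open>u\<close> and \<open>e\<close>.\<close>

lemma X_symplectic: "transpose_mat X * J_mat n = - (J_mat n * X)"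
proof -
  have JX: "(J_mat n * X) $$ (i, j) = cnj (ju i) * cnj (e j) - cnj (je i) * cnj (u j)
      - cnj (u i) * cnj (je j) + cnj (e i) * cnj (ju j)" if ij: "i < 2*n" "j < 2*n" for i j
  proof -
    have "(J_mat n * X) $$ (i, j) = (if i < n then X $$ (i + n, j) else - X $$ (i - n, j))"
      using ij by (simp add: index_mult_mat_sum[of _ "2*n" "2*n" _ "2*n"] sum_J_mat del: index_mult_mat)
    then show ?thesis using ij by (auto simp: rot_gen_def qconj_def)
  qed
  have "transpose_mat (J_mat n * X) = J_mat n * X"
    by (rule eq_matI) (use JX in \<open>auto simp: rot_gen_def[of n e u] simp del: index_mult_mat(1)\<close>)
  moreover have "transpose_mat (J_mat n * X) = - (transpose_mat X * J_mat n)"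
    by (simp add: transpose_mult[of _ "2*n" "2*n" _ "2*n"] J_mat_skew
        uminus_mult_right_mat rot_gen_def)
  ultimately show ?thesis by (metis uminus_uminus_mat)
qed


lemma dim_X [simp]: "dim_row X = 2*n" "dim_col X = 2*n"
  by (simp_all add: rot_gen_def)

lemma X_square_cube: "(X * X) * X = - X" "(X * X) * (X * X) = - (X * X)"
  using X_cube by (simp_all add: assoc_mult_mat[OF X_carrier X_carrier X_carrier]
      assoc_mult_mat[OF X_carrier X_carrier mult_carrier_mat[OF X_carrier X_carrier]])

text \<open>Rotations and products of rotations are polynomials in \<open>X\<close> of degree at most two, by
  \<open>X\<^sup>3 = - X\<close>. Computing with arbitrary coefficients keeps the trigonometry out of the matrix
  algebra.\<close>

definition X_poly :: "complex \<Rightarrow> complex \<Rightarrow> complex mat" where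
  "X_poly a b = 1\<^sub>m (2*n) + a \<cdot>\<^sub>m X + b \<cdot>\<^sub>m (X * X)"

lemma XX_carrier [simp]: "X * X \<in> carrier_mat (2*n) (2*n)"
  by (rule mult_carrier_mat[OF X_carrier X_carrier])

lemma X_poly_carrier [simp]: "X_poly a b \<in> carrier_mat (2*n) (2*n)"
  by (rule carrier_matI) (simp_all add: X_poly_def)

lemma dim_X_poly [simp]: "dim_row (X_poly a b) = 2*n" "dim_col (X_poly a b) = 2*n"
  by (simp_all add: X_poly_def)

lemma mult_X_poly:
  assumes "A \<in> carrier_mat (2*n) (2*n)"
  shows "A * X_poly a b = A + a \<cdot>\<^sub>m (A * X) + b \<cdot>\<^sub>m (A * (X * X))"
proof -
  have s: "a \<cdot>\<^sub>m X \<in> carrier_mat (2*n) (2*n)" "b \<cdot>\<^sub>m (X * X) \<in> carrier_mat (2*n) (2*n)" for a b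
    by simp_all
  show ?thesis unfolding X_poly_def
    by (simp only: mult_add_distrib_mat[OF assms add_carrier_mat[OF s(1)] s(2)]
        mult_add_distrib_mat[OF assms one_carrier_mat s(1)]
        mult_smult_distrib[OF assms X_carrier] mult_smult_distrib[OF assms XX_carrier]
        right_mult_one_mat[OF assms])
qed

lemma X_poly_mult:
  assumes "A \<in> carrier_mat (2*n) (2*n)"
  shows "X_poly a b * A = A + a \<cdot>\<^sub>m (X * A) + b \<cdot>\<^sub>m (X * X * A)"
proof -
  have s: "a \<cdot>\<^sub>m X \<in> carrier_mat (2*n) (2*n)" "b \<cdot>\<^sub>m (X * X) \<in> carrier_mat (2*n) (2*n)" for a b
    by simp_all
  show ?thesis unfolding X_poly_def
    by (simp only: add_mult_distrib_mat[OF add_carrier_mat[OF s(1)] s(2) assms]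
        add_mult_distrib_mat[OF one_carrier_mat s(1) assms]
        mult_smult_assoc_mat[OF X_carrier assms] mult_smult_assoc_mat[OF XX_carrier assms]
        left_mult_one_mat[OF assms])
qed

lemma X_poly_mult_X_poly: "X_poly a b * X_poly c d = X_poly (a + c - a * d - b * c) (b + d + a * c - b * d)"
  unfolding X_poly_mult[OF X_poly_carrier] mult_X_poly[OF X_carrier] mult_X_poly[OF XX_carrier] X_cube X_square_cube
  by (rule eq_matI) (simp_all add: X_poly_def algebra_simps del: index_mult_mat(1))

lemma rot_eq: "rot n e u t = X_poly (complex_of_real (sin t)) (complex_of_real (1 - cos t))"
  by (simp add: rot_def X_poly_def)

lemma X_poly_zero: "X_poly 0 0 = 1\<^sub>m (2*n)"
  by (rule eq_matI) (simp_all add: X_poly_def del: index_mult_mat(1))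

lemma rot_inverse: "rot n e u (- t) * rot n e u t = 1\<^sub>m (2*n)"
proof -
  have "complex_of_real (cos t * cos t + sin t * sin t) = 1"
    by (metis sin_cos_squared_add3 of_real_1)
  then have "complex_of_real (cos t) * complex_of_real (cos t) +
      complex_of_real (sin t) * complex_of_real (sin t) = 1"
    by (simp only: of_real_add of_real_mult)
  then show ?thesis
    unfolding rot_eq X_poly_mult_X_poly X_poly_zero[symmetric]
    by (intro arg_cong2[where f = X_poly]) (simp_all add: algebra_simps)
qed

lemma rot_adjoint: "mat_adjoint (rot n e u t) = rot n e u (- t)"
proof (rule eq_matI)
  fix i j assume "i < dim_row (rot n e u (- t))" "j < dim_col (rot n e u (- t))"
  then have ij: "i < 2*n" "j < 2*n" by (auto simp: rot_eq)
  have 1: "cnj (X $$ (j, i)) = - X $$ (i, j)"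
    using ij by (simp add: rot_gen_def)
  have 2: "cnj ((X * X) $$ (j, i)) = (X * X) $$ (i, j)"
    using ij by (simp add: X_square)
  show "mat_adjoint (rot n e u t) $$ (i, j) = rot n e u (- t) $$ (i, j)"
    using ij 1 2 by (simp add: index_mat_adjoint rot_eq X_poly_def del: index_mult_mat(1))
qed (auto simp: rot_eq)

text \<open>The Lie algebra relation \<open>X\<^sup>t J = - J X\<close> exponentiated: moving \<open>J\<close> past a rotation reverses
  the angle.\<close>

lemma rot_symplectic: "transpose_mat (rot n e u t) * J_mat n = J_mat n * rot n e u (- t)"
proof -
  let ?J = "J_mat n"
  have t: "transpose_mat X \<in> carrier_mat (2*n) (2*n)" by simp
  have "transpose_mat (X * X) * ?J = transpose_mat X * (transpose_mat X * ?J)"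
    by (simp add: transpose_mult[OF X_carrier X_carrier] assoc_mult_mat[OF t t J_mat_carrier])
  also have "\<dots> = - (transpose_mat X * ?J * X)"
    by (simp add: X_symplectic assoc_mult_mat[OF t J_mat_carrier X_carrier, symmetric]
        del: assoc_mult_mat)
  also have "\<dots> = ?J * (X * X)"
    by (simp add: X_symplectic assoc_mult_mat[OF J_mat_carrier X_carrier X_carrier]
        del: assoc_mult_mat)
  finally have XX: "transpose_mat (X * X) * ?J = ?J * (X * X)" .
  have "transpose_mat (X_poly a b) * ?J = ?J + a \<cdot>\<^sub>m (transpose_mat X * ?J) + b \<cdot>\<^sub>m (transpose_mat (X * X) * ?J)" for a b
  proof -
    have tr: "transpose_mat (X_poly a b) = 1\<^sub>m (2*n) + a \<cdot>\<^sub>m transpose_mat X + b \<cdot>\<^sub>m transpose_mat (X * X)"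
      by (rule eq_matI) (auto simp: X_poly_def simp del: index_mult_mat(1))
    have t2: "transpose_mat (X * X) \<in> carrier_mat (2*n) (2*n)" by simp
    have s: "a \<cdot>\<^sub>m transpose_mat X \<in> carrier_mat (2*n) (2*n)"
      "b \<cdot>\<^sub>m transpose_mat (X * X) \<in> carrier_mat (2*n) (2*n)"
      using t t2 by simp_all
    show ?thesis unfolding tr
      by (simp only: add_mult_distrib_mat[OF add_carrier_mat[OF s(1)] s(2) J_mat_carrier]
        add_mult_distrib_mat[OF one_carrier_mat s(1) J_mat_carrier]
        mult_smult_assoc_mat[OF t J_mat_carrier] mult_smult_assoc_mat[OF t2 J_mat_carrier]
        left_mult_one_mat[OF J_mat_carrier])
  qed
  then show ?thesis
    unfolding rot_eq mult_X_poly[OF J_mat_carrier] X_symplectic XX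
    by (intro eq_matI) (simp_all del: index_mult_mat(1))
qed

lemma rot_carrier [simp]: "rot n e u t \<in> carrier_mat (2*n) (2*n)"
  by (simp add: rot_eq)

lemma rot_USp: "rot n e u t \<in> USp n"
proof -
  have "transpose_mat (rot n e u t) * J_mat n * rot n e u t = J_mat n * (rot n e u (- t) * rot n e u t)"
    unfolding rot_symplectic by (rule assoc_mult_mat[OF J_mat_carrier rot_carrier rot_carrier])
  then show ?thesis
    by (simp add: USp_def rot_adjoint rot_inverse)
qed

text \<open>The right-hand side is the derivative of \<open>rot n e u\<close> at \<open>t\<close>, so the curve has the
  left-invariant velocity \<open>X\<close>.\<close>

lemma rot_mult_X: "rot n e u t * X = complex_of_real (cos t) \<cdot>\<^sub>m X + complex_of_real (sin t) \<cdot>\<^sub>m (X * X)"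
  unfolding rot_eq X_poly_mult[OF X_carrier] X_square_cube
  by (rule eq_matI) (simp_all add: algebra_simps del: index_mult_mat(1))

text \<open>The trace of \<open>X\<^sup>2\<close> is \<open>-4\<close>, since \<open>- X\<^sup>2\<close> projects onto a space of complex dimension four.
  Hence \<open>X\<close> has length \<open>sqrt 2\<close>, whatever \<open>n\<close> is.\<close>

lemma lie_inner_X: "lie_inner (complex_of_real k \<cdot>\<^sub>m X) (complex_of_real k \<cdot>\<^sub>m X) = 2 * k\<^sup>2"
proof -
  have "(complex_of_real k \<cdot>\<^sub>m X) * (complex_of_real k \<cdot>\<^sub>m X) = complex_of_real (k\<^sup>2) \<cdot>\<^sub>m (X * X)"
    unfolding mult_smult_assoc_mat[OF X_carrier smult_carrier_mat[OF X_carrier]]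
      mult_smult_distrib[OF X_carrier X_carrier]
    by (rule eq_matI) (simp_all add: power2_eq_square del: index_mult_mat(1))
  moreover have "mat_trace (X * X) = - 4"
  proof -
    have "mat_trace (X * X) = - (herm (2*n) e e + herm (2*n) u u + herm (2*n) je je + herm (2*n) ju ju)"
      unfolding mat_trace_def herm_def X_square by (simp add: sum.distrib sum_negf sum_subtractf)
    then show ?thesis by (simp add: e_e u_u frame_products)
  qed
  moreover have "mat_trace (c \<cdot>\<^sub>m (X * X)) = c * mat_trace (X * X)" for c
    by (simp add: mat_trace_def sum_distrib_left del: index_mult_mat(1))
  ultimately show ?thesis by (simp add: lie_inner_def)
qed


text \<open>The translated rotation has constant speed \<open>sqrt 2 * \<bar>\<theta>\<bar>\<close>: its velocity is the point of the
  curve times \<open>\<theta> X\<close>, and the adjoint of that point in the metric cancels it.\<close>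

lemma USp_length_rot:
  assumes g: "g \<in> USp n"
  shows "USp_length n (\<lambda>s. g * rot n e u (\<theta> * s)) = ennreal (sqrt 2 * \<bar>\<theta>\<bar>)"
    and "(\<lambda>s. g * rot n e u (\<theta> * s)) \<in> USp_curves n g (g * rot n e u \<theta>)"
proof -
  define c where "c = (\<lambda>s. g * rot n e u (\<theta> * s))"
  note gc = USp_carrier[OF g]
  have [simp]: "dim_row g = 2*n" "dim_col g = 2*n" using gc by auto
  have c_USp: "c s \<in> USp n" for s
    unfolding c_def by (rule USp_mult[OF g rot_USp])
  have entry: "c s $$ (i, j) = g $$ (i, j) + complex_of_real (sin (\<theta> * s)) * (g * X) $$ (i, j)
      + complex_of_real (1 - cos (\<theta> * s)) * (g * (X * X)) $$ (i, j)"
    if "i < 2*n" "j < 2*n" for i j s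
    using that unfolding c_def rot_eq mult_X_poly[OF gc] by (simp del: index_mult_mat(1))
  define d where "d i j s = complex_of_real \<theta> * (complex_of_real (cos (\<theta> * s)) * (g * X) $$ (i, j)
      + complex_of_real (sin (\<theta> * s)) * (g * (X * X)) $$ (i, j))" for i j s
  have deriv: "((\<lambda>s. c s $$ (i, j)) has_vector_derivative d i j s) (at s)"
    if "i < 2*n" "j < 2*n" for i j s
    unfolding entry[OF that] d_def
    by (rule derivative_eq_intros has_vector_derivative_real_field refl | simp add: algebra_simps scaleR_conv_of_real)+
  have vel: "mat_velocity n c s = c s * (complex_of_real \<theta> \<cdot>\<^sub>m X)" for s
  proof -
    have "c s * (complex_of_real \<theta> \<cdot>\<^sub>m X) = complex_of_real \<theta> \<cdot>\<^sub>m (g * (rot n e u (\<theta> * s) * X))"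
      unfolding c_def mult_smult_distrib[OF mult_carrier_mat[OF gc rot_carrier] X_carrier]
        assoc_mult_mat[OF gc rot_carrier X_carrier] ..
    also have "\<dots> = complex_of_real \<theta> \<cdot>\<^sub>m (complex_of_real (cos (\<theta> * s)) \<cdot>\<^sub>m (g * X)
        + complex_of_real (sin (\<theta> * s)) \<cdot>\<^sub>m (g * (X * X)))"
      unfolding rot_mult_X
        mult_add_distrib_mat[OF gc smult_carrier_mat[OF X_carrier] smult_carrier_mat[OF XX_carrier]]
        mult_smult_distrib[OF gc X_carrier] mult_smult_distrib[OF gc XX_carrier] ..
    also have "\<dots> = mat_velocity n c s"
      unfolding mat_velocity_def
      by (rule eq_matI) (simp_all add: vector_derivative_at[OF deriv] d_def del: index_mult_mat(1))
    finally show ?thesis ..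
  qed
  have metric: "USp_metric (c s) (mat_velocity n c s) (mat_velocity n c s) = 2 * \<theta>\<^sup>2" for s
  proof -
    have "mat_adjoint (c s) * (c s * (complex_of_real \<theta> \<cdot>\<^sub>m X)) = complex_of_real \<theta> \<cdot>\<^sub>m X"
      unfolding assoc_mult_mat[OF mat_adjoint_carrier[OF USp_carrier[OF c_USp]] USp_carrier[OF c_USp]
          smult_carrier_mat[OF X_carrier], symmetric] USpD(2)[OF c_USp]
      by (rule left_mult_one_mat[OF smult_carrier_mat[OF X_carrier]])
    then show ?thesis unfolding USp_metric_def vel by (simp only: lie_inner_X)
  qed
  show "USp_length n (\<lambda>s. g * rot n e u (\<theta> * s)) = ennreal (sqrt 2 * \<bar>\<theta>\<bar>)"
    unfolding c_def[symmetric] USp_length_def metric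
    by (simp add: real_sqrt_mult nn_integral_cmult_indicator)
  have "(\<lambda>s. c s $$ (i, j)) piecewise_C1_differentiable_on {0..1}" if ij: "i < 2*n" "j < 2*n" for i j
  proof -
    have "continuous_on {0..1} (d i j)"
      unfolding d_def by (intro continuous_intros)
    then have "(\<lambda>s. c s $$ (i, j)) C1_differentiable_on {0..1}"
      unfolding C1_differentiable_on_def using deriv[OF ij] by blast
    then show ?thesis by (rule C1_differentiable_imp_piecewise)
  qed
  moreover have "c 0 = g"
    unfolding c_def rot_eq by (simp add: X_poly_zero right_mult_one_mat[OF gc])
  ultimately show "(\<lambda>s. g * rot n e u (\<theta> * s)) \<in> USp_curves n g (g * rot n e u \<theta>)"
    unfolding c_def[symmetric] USp_curves_def using c_USp by (auto simp: c_def)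
qed

lemma USp_dist_rot:
  assumes "g \<in> USp n"
  shows "USp_dist n g (g * rot n e u \<theta>) \<le> ennreal (sqrt 2 * \<bar>\<theta>\<bar>)"
  unfolding USp_dist_def
  using INF_lower[OF USp_length_rot(2)[OF assms, of \<theta>], of "USp_length n"] USp_length_rot(1)[OF assms, of \<theta>]
  by simp

end

section \<open>Moving a group element into the preimage of an equator\<close>

lemma USp_mult_adjoint:
  assumes "g \<in> USp n"
  shows "g * mat_adjoint g = 1\<^sub>m (2*n)"
  using mat_mult_left_right_inverse[OF mat_adjoint_carrier[OF USpD(1)[OF assms]] USpD(1,2)[OF assms]] .

lemma USp_column_norm:
  assumes g: "g \<in> USp n" and c: "c < 2*n"
  shows "(\<Sum>i<2*n. (cmod (g $$ (i, c)))\<^sup>2) = 1"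
proof -
  note gc = USpD(1)[OF g]
  have "complex_of_real (\<Sum>i<2*n. (cmod (g $$ (i, c)))\<^sup>2) = (mat_adjoint g * g) $$ (c, c)"
    using c carrier_matD[OF gc]
    by (simp add: index_mult_mat_sum[OF mat_adjoint_carrier[OF gc] gc] index_mat_adjoint
        complex_norm_square mult.commute del: index_mult_mat of_real_power)
  then have "complex_of_real (\<Sum>i<2*n. (cmod (g $$ (i, c)))\<^sup>2) = 1"
    unfolding USpD(2)[OF g] using c by simp
  then show ?thesis by (metis of_real_eq_1_iff)
qed

lemma USp_row_orthonormal:
  assumes g: "g \<in> USp n" and i: "i < 2*n" and j: "j < 2*n"
  shows "(\<Sum>k<2*n. g $$ (i, k) * cnj (g $$ (j, k))) = (if i = j then 1 else 0)"
proof -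
  note gc = USpD(1)[OF g]
  have "(\<Sum>k<2*n. g $$ (i, k) * cnj (g $$ (j, k))) = (g * mat_adjoint g) $$ (i, j)"
    using i j carrier_matD[OF gc]
    by (simp add: index_mult_mat_sum[OF gc mat_adjoint_carrier[OF gc]] index_mat_adjoint del: index_mult_mat)
  then show ?thesis using USp_mult_adjoint[OF g] i j by simp
qed

abbreviation col_herm :: "nat \<Rightarrow> (nat \<Rightarrow> complex) \<Rightarrow> nat \<Rightarrow> complex mat \<Rightarrow> complex" where
  "col_herm n v c g \<equiv> herm (2*n) (\<lambda>i. g $$ (i, c)) v"

text \<open>The Hermitian products of \<open>v\<close> with the columns of \<open>g\<close> are the coordinates of \<open>v\<close> in an
  orthonormal basis.\<close>

lemma col_herm_parseval:
  assumes g: "g \<in> USp n"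
  shows "(\<Sum>k<2*n. col_herm n v k g * cnj (col_herm n v k g)) = herm (2*n) v v"
proof -
  have "(\<Sum>k<2*n. col_herm n v k g * cnj (col_herm n v k g)) =
      (\<Sum>k<2*n. \<Sum>i<2*n. \<Sum>j<2*n. cnj (v i) * v j * (g $$ (i, k) * cnj (g $$ (j, k))))"
    unfolding herm_def cnj_sum sum_product by (intro sum.cong refl) (simp add: algebra_simps)
  also have "\<dots> = (\<Sum>i<2*n. \<Sum>j<2*n. \<Sum>k<2*n. cnj (v i) * v j * (g $$ (i, k) * cnj (g $$ (j, k))))"
    by (subst sum.swap, intro sum.cong refl sum.swap)
  also have "\<dots> = (\<Sum>i<2*n. \<Sum>j<2*n. if i = j then cnj (v i) * v j else 0)"
    unfolding sum_distrib_left[symmetric]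
    by (intro sum.cong refl) (simp add: USp_row_orthonormal[OF g])
  also have "\<dots> = herm (2*n) v v"
    by (simp add: herm_def mult.commute)
  finally show ?thesis .
qed

text \<open>Let \<open>w = g\<^sup>* v\<close>. The smallness hypothesis says that at most half of the unit mass of \<open>w\<close> lies on
  the quaternionic line of the first basis vector \<open>e\<close>. The component of \<open>w\<close> off this line thus has
  norm \<open>r\<close> with \<open>r\<^sup>2 \<ge> 1/2\<close>; let \<open>u\<close> be its direction. Right multiplication of \<open>g\<close> by the rotation
  from \<open>e\<close> towards \<open>u\<close> changes the height \<open>a = Re w\<^sub>0\<close> of the first column over the equator to
  \<open>cos \<theta> * a + sin \<theta> * r\<close>, which vanishes at \<open>tan \<theta> = - a / r\<close>. As \<open>r\<close> is bounded below, this
  angle is of the order of \<open>\<bar>a\<bar>\<close>.\<close>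

lemma rotate_into_equator:
  assumes n: "0 < n" and g: "g \<in> USp n" and v: "herm (2*n) v v = 1"
    and small: "(cmod (col_herm n v 0 g))\<^sup>2 + (cmod (col_herm n v n g))\<^sup>2 \<le> 1/2"
  obtains h where "h \<in> USp n" "Re (col_herm n v 0 h) = 0"
    "USp_dist n g h \<le> ennreal (2 * \<bar>Re (col_herm n v 0 g)\<bar>)"
proof -
  note gc = USpD(1)[OF g]
  define w where "w k = cnj (col_herm n v k g)" for k
  define W where "W = (\<Sum>k\<in>{..<2*n} - {0, n}. (cmod (w k))\<^sup>2)"
  define r where "r = sqrt W"
  define a where "a = Re (w 0)"
  have "complex_of_real (\<Sum>k<2*n. (cmod (w k))\<^sup>2) = 1"
    using col_herm_parseval[OF g, of v] v
    by (simp add: w_def complex_norm_square mult.commute del: of_real_power)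
  then have total: "(\<Sum>k<2*n. (cmod (w k))\<^sup>2) = 1"
    by (metis of_real_eq_1_iff)
  have "(\<Sum>k<2*n. (cmod (w k))\<^sup>2) = W + (\<Sum>k\<in>{0, n}. (cmod (w k))\<^sup>2)"
    unfolding W_def using n by (intro sum.subset_diff) auto
  then have W: "W \<ge> 1/2" using total small n by (simp add: w_def)
  then have r: "r > 0" "r\<^sup>2 = W" "1 \<le> sqrt 2 * r"
    by (simp_all add: r_def real_sqrt_mult[symmetric])
  define e :: "nat \<Rightarrow> complex" where "e k = (if k = 0 then 1 else 0)" for k
  define u where "u k = (if k = 0 \<or> k = n then 0 else w k / r)" for k
  have uw: "(\<Sum>k<2*n. u k * cnj (w k)) = r"
  proof -
    have "(\<Sum>k<2*n. u k * cnj (w k)) = (\<Sum>k\<in>{..<2*n} - {0, n}. u k * cnj (w k))"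
      by (rule sum.mono_neutral_right) (auto simp: u_def)
    also have "\<dots> = (\<Sum>k\<in>{..<2*n} - {0, n}. complex_of_real ((cmod (w k))\<^sup>2) / r)"
      by (rule sum.cong) (auto simp: u_def complex_norm_square simp del: of_real_power)
    also have "\<dots> = complex_of_real (W / r)"
      by (simp add: W_def sum_divide_distrib)
    also have "W / r = r" using r by (simp add: power2_eq_square field_simps)
    finally show ?thesis .
  qed
  have "herm (2*n) u u = (\<Sum>k<2*n. u k * cnj (w k)) / r"
    unfolding herm_def sum_divide_distrib by (rule sum.cong) (auto simp: u_def)
  then have uu: "herm (2*n) u u = 1" using uw r by simp
  have pick: "herm (2*n) z e = z 0" for z
  proof -
    have "herm (2*n) z e = (\<Sum>k<2*n. if k = 0 then z k else 0)"
      unfolding herm_def e_def by (intro sum.cong) auto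
    then show ?thesis using n by simp
  qed
  interpret quat_frame n e u
  proof
    show "herm (2*n) e e = 1" by (simp add: pick) (simp add: e_def)
    show "herm (2*n) u e = 0" by (simp add: pick) (simp add: u_def)
    show "herm (2*n) (qconj n u) e = 0" using n by (simp add: pick) (simp add: u_def qconj_def)
  qed (rule uu)
  \<comment> \<open>The entries of \<open>j e\<close> and \<open>j u\<close> at index \<open>0\<close> are conjugates of the entries of \<open>e\<close> and \<open>u\<close> at index \<open>n\<close>, which vanish.\<close>
  have column: "rot n e u t $$ (k, 0) = of_real (cos t) * e k + of_real (sin t) * u k" if "k < 2*n" for t k
  proof -
    have "X $$ (k, 0) = u k" "(X * X) $$ (k, 0) = - e k"
      using that n unfolding X_square
      by (simp_all add: rot_gen_def) (simp_all add: qconj_def u_def e_def)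
    then show ?thesis
      using that n unfolding rot_eq X_poly_def
      by (simp add: e_def algebra_simps del: index_mult_mat(1))
  qed
  have pairing: "col_herm n v 0 (g * rot n e u t) = of_real (cos t) * cnj (w 0) + of_real (sin t) * r" for t
  proof -
    have "col_herm n v 0 (g * rot n e u t)
        = (\<Sum>i<2*n. \<Sum>k<2*n. g $$ (i, k) * rot n e u t $$ (k, 0) * cnj (v i))"
      unfolding herm_def using n
      by (intro sum.cong refl) (simp add: index_mult_mat_sum[OF gc rot_carrier] sum_distrib_right del: index_mult_mat)
    also have "\<dots> = (\<Sum>k<2*n. \<Sum>i<2*n. g $$ (i, k) * rot n e u t $$ (k, 0) * cnj (v i))"
      by (rule sum.swap)
    also have "\<dots> = (\<Sum>k<2*n. rot n e u t $$ (k, 0) * cnj (w k))"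
      by (simp add: w_def herm_def sum_distrib_left algebra_simps)
    also have "\<dots> = (\<Sum>k<2*n. of_real (cos t) * (cnj (w k) * cnj (e k)) + of_real (sin t) * (u k * cnj (w k)))"
      by (intro sum.cong refl) (simp add: column algebra_simps e_def)
    also have "\<dots> = of_real (cos t) * herm (2*n) (\<lambda>k. cnj (w k)) e + of_real (sin t) * (\<Sum>k<2*n. u k * cnj (w k))"
      by (simp add: sum.distrib sum_distrib_left herm_def)
    finally show ?thesis by (simp add: uw pick)
  qed
  define \<theta> where "\<theta> = - arctan (a / r)"
  have "Re (col_herm n v 0 (g * rot n e u \<theta>)) = cos \<theta> * a + sin \<theta> * r"
    by (simp add: pairing a_def)
  also have "\<dots> = cos \<theta> * (a + tan \<theta> * r)"
    by (simp add: tan_def \<theta>_def algebra_simps)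
  also have "\<dots> = 0"
    using r by (simp add: \<theta>_def tan_arctan)
  finally have zero: "Re (col_herm n v 0 (g * rot n e u \<theta>)) = 0" .
  have "\<bar>\<theta>\<bar> \<le> \<bar>a / r\<bar>" unfolding \<theta>_def using abs_arctan_le[of "a / r"] by simp
  then have "sqrt 2 * \<bar>\<theta>\<bar> \<le> sqrt 2 * (\<bar>a\<bar> / r)"
    using r by (intro mult_left_mono) auto
  also have "\<dots> \<le> sqrt 2 * (\<bar>a\<bar> * sqrt 2)"
  proof (intro mult_left_mono)
    show "\<bar>a\<bar> / r \<le> \<bar>a\<bar> * sqrt 2"
      using r mult_left_mono[OF r(3), of "\<bar>a\<bar>"] by (simp add: field_simps)
  qed simp
  also have "\<dots> = 2 * \<bar>Re (col_herm n v 0 g)\<bar>" by (simp add: a_def w_def)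
  finally have "ennreal (sqrt 2 * \<bar>\<theta>\<bar>) \<le> ennreal (2 * \<bar>Re (col_herm n v 0 g)\<bar>)"
    by (rule ennreal_leI)
  then show thesis
    using that[OF USp_mult[OF g rot_USp] zero] USp_dist_rot[OF g] by (meson order_trans)
qed

section \<open>Signed permutations of the quaternionic coordinates\<close>

definition signed_perm :: "nat \<Rightarrow> (nat \<Rightarrow> nat) \<Rightarrow> (nat \<Rightarrow> real) \<Rightarrow> complex mat" where
  "signed_perm n \<sigma> d = mat (2*n) (2*n) (\<lambda>(i, j). if i = \<sigma> j then complex_of_real (d j) else 0)"

text \<open>An involution \<open>\<tau>\<close> of the quaternionic coordinates together with compatible signs \<open>s\<close>. The index
  \<open>i < n\<close> stands for the coordinate line formed by the complex indices \<open>i\<close> and \<open>i + n\<close>. Applying the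
  same permutation and signs to both halves makes the matrix commute with \<open>J\<close>.\<close>

locale line_symmetry =
  fixes n :: nat and \<tau> :: "nat \<Rightarrow> nat" and s :: "nat \<Rightarrow> real"
  assumes \<tau>_less: "i < n \<Longrightarrow> \<tau> i < n" and \<tau>_\<tau>: "i < n \<Longrightarrow> \<tau> (\<tau> i) = i"
    and s_\<tau>: "i < n \<Longrightarrow> s (\<tau> i) = s i" and s_s: "i < n \<Longrightarrow> s i * s i = 1"
begin

definition \<sigma> :: "nat \<Rightarrow> nat" where "\<sigma> i = (if i < n then \<tau> i else \<tau> (i - n) + n)"
definition d :: "nat \<Rightarrow> real" where "d i = (if i < n then s i else s (i - n))"

abbreviation "K \<equiv> signed_perm n \<sigma> d"

lemma \<sigma>_less: "i < 2*n \<Longrightarrow> \<sigma> i < 2*n"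
  using \<tau>_less[of i] \<tau>_less[of "i - n"] by (auto simp: \<sigma>_def)

lemma \<sigma>_\<sigma>: "i < 2*n \<Longrightarrow> \<sigma> (\<sigma> i) = i"
  using \<tau>_less[of i] \<tau>_less[of "i - n"] \<tau>_\<tau>[of i] \<tau>_\<tau>[of "i - n"] by (auto simp: \<sigma>_def)

lemma d_\<sigma>: "i < 2*n \<Longrightarrow> d (\<sigma> i) = d i"
  using \<tau>_less[of i] \<tau>_less[of "i - n"] s_\<tau>[of i] s_\<tau>[of "i - n"] by (auto simp: \<sigma>_def d_def)

lemma d_d: "i < 2*n \<Longrightarrow> d i * d i = 1"
  using s_s[of i] s_s[of "i - n"] by (auto simp: d_def)

lemma \<sigma>_eq_iff: "i < 2*n \<Longrightarrow> j < 2*n \<Longrightarrow> i = \<sigma> j \<longleftrightarrow> j = \<sigma> i"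
  using \<sigma>_\<sigma> by metis

lemma K_carrier [simp]: "K \<in> carrier_mat (2*n) (2*n)"
  by (simp add: signed_perm_def)

lemma dim_K [simp]: "dim_row K = 2*n" "dim_col K = 2*n"
  by (simp_all add: signed_perm_def)

lemma K_index:
  assumes "i < 2*n" "j < 2*n"
  shows "K $$ (i, j) = (if j = \<sigma> i then complex_of_real (d i) else 0)"
  using \<sigma>_eq_iff[OF assms] d_\<sigma>[OF assms(1)] assms by (simp add: signed_perm_def)

lemma K_sum:
  assumes "i < 2*n"
  shows "(\<Sum>k<2*n. K $$ (i, k) * z k) = complex_of_real (d i) * z (\<sigma> i)"
proof -
  have "(\<Sum>k<2*n. K $$ (i, k) * z k) = (\<Sum>k<2*n. if k = \<sigma> i then complex_of_real (d i) * z k else 0)"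
    using assms \<sigma>_eq_iff[OF assms] d_\<sigma>[OF assms] by (intro sum.cong) (auto simp: signed_perm_def)
  then show ?thesis using \<sigma>_less[OF assms] by simp
qed

lemma K_mult_index:
  assumes "A \<in> carrier_mat (2*n) (2*n)" "i < 2*n" "j < 2*n"
  shows "(K * A) $$ (i, j) = complex_of_real (d i) * A $$ (\<sigma> i, j)"
  unfolding index_mult_mat_sum[OF K_carrier assms] by (rule K_sum[OF assms(2)])

lemma K_symmetric: "transpose_mat K = K"
  by (rule eq_matI) (use \<sigma>_eq_iff d_\<sigma> in \<open>auto simp: signed_perm_def\<close>)

lemma K_adjoint: "mat_adjoint K = K"
  by (rule eq_matI) (use \<sigma>_eq_iff d_\<sigma> in \<open>auto simp: index_mat_adjoint signed_perm_def\<close>)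

lemma K_K: "K * K = 1\<^sub>m (2*n)"
proof (rule eq_matI)
  fix i j assume "i < dim_row (1\<^sub>m (2*n) :: complex mat)" "j < dim_col (1\<^sub>m (2*n) :: complex mat)"
  then have ij: "i < 2*n" "j < 2*n" by auto
  then show "(K * K) $$ (i, j) = 1\<^sub>m (2*n) $$ (i, j)"
    using \<sigma>_less[of i] \<sigma>_\<sigma>[of i] \<sigma>_\<sigma>[of j] d_d[of i] unfolding K_mult_index[OF K_carrier ij]
    by (auto simp: signed_perm_def of_real_mult[symmetric] simp del: of_real_mult)
qed auto

lemma K_J: "K * J_mat n = J_mat n * K"
proof (rule eq_matI)
  fix i j assume "i < dim_row (J_mat n * K)" "j < dim_col (J_mat n * K)"
  then have ij: "i < 2*n" "j < 2*n" by auto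
  have J: "(J_mat n * K) $$ (i, j) = (if i < n then K $$ (i + n, j) else - K $$ (i - n, j))"
    unfolding index_mult_mat_sum[OF J_mat_carrier K_carrier ij] by (rule sum_J_mat[OF ij(1)])
  show "(K * J_mat n) $$ (i, j) = (J_mat n * K) $$ (i, j)"
  proof (cases "i < n")
    case True
    then have "\<sigma> i = \<tau> i" "\<sigma> (i + n) = \<tau> i + n" "d (i + n) = d i" "\<tau> i < n"
      by (simp_all add: \<sigma>_def d_def \<tau>_less)
    then show ?thesis
      unfolding K_mult_index[OF J_mat_carrier ij] J using True ij
      by (simp add: K_index index_J_mat)
  next
    case False
    then have "\<sigma> i = \<tau> (i - n) + n" "\<sigma> (i - n) = \<tau> (i - n)" "d (i - n) = d i" "\<tau> (i - n) < n"
      using ij by (simp_all add: \<sigma>_def d_def \<tau>_less)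
    then show ?thesis
      unfolding K_mult_index[OF J_mat_carrier ij] J using False ij
      by (auto simp add: K_index index_J_mat)
  qed
qed auto

lemma K_USp: "K \<in> USp n"
proof -
  have "transpose_mat K * J_mat n * K = J_mat n * (K * K)"
    unfolding K_symmetric K_J by (rule assoc_mult_mat[OF J_mat_carrier K_carrier K_carrier])
  then show ?thesis by (simp add: USp_def K_adjoint K_K)
qed

end

section \<open>Invariant probability measures\<close>

locale haar =
  fixes n :: nat and M :: "complex mat measure"
  assumes n_pos: "0 < n" and haar: "is_haar_measure n M"
begin

sublocale prob_space M using haar by (simp add: is_haar_measure_def)

lemma space_M: "space M = USp n" and sets_M: "sets M = sets (USp_borel n)"
  using haar by (auto simp: is_haar_measure_def)

lemma mat_entries_measurable: "mat_entries \<in> borel_measurable M"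
  using measurable_vimage_algebra1[of mat_entries "USp n" borel]
  by (simp add: measurable_cong_sets[OF sets_M] USp_borel_def)

lemma entry_measurable [measurable]:
  assumes "i < 2*n" "j < 2*n"
  shows "(\<lambda>g. g $$ (i, j)) \<in> borel_measurable M"
proof -
  have "(\<lambda>g. mat_entries g i j) \<in> borel_measurable M"
    by (rule measurable_product_then_coordinatewise[OF
          measurable_product_then_coordinatewise[OF mat_entries_measurable]])
  moreover have "mat_entries g i j = g $$ (i, j)" if "g \<in> space M" for g
    using assms carrier_matD[of g] USp_carrier[of g n] that
    by (simp add: space_M mat_entries_def)
  ultimately show ?thesis by (simp cong: measurable_cong)
qed

lemma left_mult_measurable:
  assumes k: "k \<in> USp n"
  shows "(\<lambda>h. k * h) \<in> measurable M M"
proof -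
  have "(\<lambda>h. mat_entries (k * h) i j) \<in> borel_measurable M" for i j
  proof (cases "i < 2*n \<and> j < 2*n")
    case True
    have "(\<lambda>h. \<Sum>r<2*n. k $$ (i, r) * h $$ (r, j)) \<in> borel_measurable M"
      using True by (intro borel_measurable_sum borel_measurable_times entry_measurable) auto
    moreover have "mat_entries (k * h) i j = (\<Sum>r<2*n. k $$ (i, r) * h $$ (r, j))"
      if "h \<in> space M" for h
    proof -
      have hc: "h \<in> carrier_mat (2*n) (2*n)" using that USp_carrier by (simp add: space_M)
      show ?thesis
        unfolding mat_entries_def using True carrier_matD[OF USp_carrier[OF k]] carrier_matD[OF hc]
        by (simp add: index_mult_mat_sum[OF USp_carrier[OF k] hc] del: index_mult_mat(1))
    qed
    ultimately show ?thesis by (simp cong: measurable_cong)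
  next
    case False
    then have "mat_entries (k * h) i j = 0" if "h \<in> space M" for h
      using that carrier_matD[OF USp_carrier[OF k]] carrier_matD[OF USp_carrier[of h n]]
      by (auto simp: space_M mat_entries_def)
    then show ?thesis by (subst measurable_cong[where g = "\<lambda>_. 0"]) auto
  qed
  then have "(\<lambda>h. mat_entries (k * h)) \<in> borel_measurable M"
    by (intro measurable_coordinatewise_then_product)
  then have "(\<lambda>h. k * h) \<in> measurable M (USp_borel n)"
    unfolding USp_borel_def
    by (intro measurable_vimage_algebra2) (use USp_mult[OF k] in \<open>auto simp: space_M\<close>)
  then show ?thesis by (simp add: measurable_cong_sets[OF refl sets_M])
qed

text \<open>For an involution \<open>k\<close> the preimage of a set under left multiplication by \<open>k\<close> is also its image,
  so the invariance of the measure of images is the invariance of the measure under push-forward.\<close>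

lemma integral_left_involution:
  fixes \<phi> :: "complex mat \<Rightarrow> real"
  assumes k: "k \<in> USp n" and kk: "k * k = 1\<^sub>m (2*n)" and \<phi>: "\<phi> \<in> borel_measurable M"
  shows "(\<integral>h. \<phi> (k * h) \<partial>M) = (\<integral>h. \<phi> h \<partial>M)"
proof -
  have kkh: "k * (k * h) = h" if "h \<in> USp n" for h
    using assoc_mult_mat[OF USp_carrier[OF k] USp_carrier[OF k] USp_carrier[OF that]]
      left_mult_one_mat[OF USp_carrier[OF that]] kk by simp
  have "distr M M (\<lambda>h. k * h) = M"
  proof (rule measure_eqI)
    fix A assume "A \<in> sets (distr M M (\<lambda>h. k * h))"
    then have A: "A \<in> sets M" by simp
    then have sub: "A \<subseteq> USp n" using sets.sets_into_space space_M by auto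
    have "(\<lambda>h. k * h) -` A \<inter> space M = (\<lambda>h. k * h) ` A"
    proof
      show "(\<lambda>h. k * h) -` A \<inter> space M \<subseteq> (\<lambda>h. k * h) ` A"
        using kkh by (auto simp: space_M intro!: image_eqI[OF sym])
      show "(\<lambda>h. k * h) ` A \<subseteq> (\<lambda>h. k * h) -` A \<inter> space M"
        using sub kkh USp_mult[OF k] unfolding space_M by fastforce
    qed
    then show "emeasure (distr M M (\<lambda>h. k * h)) A = emeasure M A"
      using A k haar by (simp add: emeasure_distr[OF left_mult_measurable[OF k] A] is_haar_measure_def)
  qed simp
  then show ?thesis
    using integral_distr[OF left_mult_measurable[OF k] \<phi>] by simp
qed

end

section \<open>Second moments of the columns\<close>

context haar
begin

context
  fixes c :: nat
  assumes c: "c < 2*n"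
begin

text \<open>Lengths and inner products are collected over a whole quaternionic coordinate, because a line
  symmetry acts on the complex indices \<open>i\<close> and \<open>i + n\<close> alike and cannot
  separate them.\<close>

definition line_norm2 :: "nat \<Rightarrow> complex mat \<Rightarrow> real" where
  "line_norm2 i g = (cmod (g $$ (i, c)))\<^sup>2 + (cmod (g $$ (i + n, c)))\<^sup>2"

definition line_inner :: "(nat \<Rightarrow> complex) \<Rightarrow> nat \<Rightarrow> complex mat \<Rightarrow> real" where
  "line_inner v i g = Re (g $$ (i, c) * cnj (v i) + g $$ (i + n, c) * cnj (v (i + n)))"

lemma line_norm2_measurable [measurable]: "i < n \<Longrightarrow> line_norm2 i \<in> borel_measurable M"
  using entry_measurable[of i c] entry_measurable[of "i + n" c] c
  unfolding line_norm2_def by simp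

lemma line_inner_measurable [measurable]: "i < n \<Longrightarrow> line_inner v i \<in> borel_measurable M"
  using entry_measurable[of i c] entry_measurable[of "i + n" c] c
  unfolding line_inner_def by simp

lemma sum_line_norm2: "g \<in> USp n \<Longrightarrow> (\<Sum>i<n. line_norm2 i g) = 1"
  using USp_column_norm[of g n c] c by (simp add: line_norm2_def sum_two_blocks)

lemma line_norm2_nonneg: "0 \<le> line_norm2 i g"
  by (simp add: line_norm2_def)

lemma line_norm2_le_1:
  assumes "g \<in> USp n" "i < n"
  shows "line_norm2 i g \<le> 1"
  using member_le_sum[of i "{..<n}" "\<lambda>i. line_norm2 i g"] assms
  by (simp add: line_norm2_nonneg sum_line_norm2)

lemma line_norm2_integrable: "i < n \<Longrightarrow> integrable M (line_norm2 i)"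
  using line_norm2_le_1 line_norm2_nonneg
  by (intro integrable_const_bound[where B = 1]) (auto simp: space_M)

lemma line_inner_square_le:
  "(line_inner v i g)\<^sup>2 \<le> ((cmod (v i))\<^sup>2 + (cmod (v (i + n)))\<^sup>2) * line_norm2 i g"
proof -
  define a b p q where "a = cmod (g $$ (i, c))" "b = cmod (g $$ (i + n, c))"
    and "p = cmod (v i)" "q = cmod (v (i + n))"
  have "\<bar>line_inner v i g\<bar> \<le> cmod (g $$ (i, c) * cnj (v i) + g $$ (i + n, c) * cnj (v (i + n)))"
    unfolding line_inner_def by (rule abs_Re_le_cmod)
  also have "\<dots> \<le> a * p + b * q"
    unfolding a_b_def p_q_def by (rule order_trans[OF norm_triangle_ineq]) (simp add: norm_mult)
  finally have "(line_inner v i g)\<^sup>2 \<le> (a * p + b * q)\<^sup>2"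
    by (metis abs_ge_zero power2_abs power_mono)
  also have "\<dots> \<le> (p\<^sup>2 + q\<^sup>2) * (a\<^sup>2 + b\<^sup>2)"
    using zero_le_power2[of "a * q - b * p"] by (simp add: power2_eq_square algebra_simps)
  finally show ?thesis by (simp add: line_norm2_def a_b_def p_q_def)
qed

text \<open>Transpositions of coordinate lines lie in the group, so the \<open>n\<close> integrals agree; they add up to
  the squared norm \<open>1\<close> of a column.\<close>

lemma integral_line_norm2:
  assumes i: "i < n"
  shows "(\<integral>g. line_norm2 i g \<partial>M) = 1 / n"
proof -
  have swap: "(\<integral>g. line_norm2 j g \<partial>M) = (\<integral>g. line_norm2 i g \<partial>M)" if j: "j < n" for j
  proof -
    interpret line_symmetry n "\<lambda>k. if k = i then j else if k = j then i else k" "\<lambda>_. 1"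
      using i j by unfold_locales auto
    have "line_norm2 i (K * g) = line_norm2 j g" if "g \<in> USp n" for g
      using i j c unfolding line_norm2_def
      by (simp add: K_mult_index[OF USp_carrier[OF that]] \<sigma>_def d_def del: index_mult_mat(1))
    then have "(\<integral>g. line_norm2 i (K * g) \<partial>M) = (\<integral>g. line_norm2 j g \<partial>M)"
      by (intro Bochner_Integration.integral_cong) (auto simp: space_M)
    then show ?thesis
      using integral_left_involution[OF K_USp K_K line_norm2_measurable[OF i]] by simp
  qed
  have "(\<integral>g. (\<Sum>j<n. line_norm2 j g) \<partial>M) = (\<integral>g. 1 \<partial>M)"
    by (intro Bochner_Integration.integral_cong) (auto simp: space_M sum_line_norm2)
  also have "\<dots> = 1" by (simp add: prob_space)
  finally have "(\<Sum>j<n. \<integral>g. line_norm2 j g \<partial>M) = 1"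
    by (subst (asm) Bochner_Integration.integral_sum) (auto intro: line_norm2_integrable)
  then have "n * (\<integral>g. line_norm2 i g \<partial>M) = 1"
    using swap by simp
  then show ?thesis using n_pos by (simp add: field_simps)
qed

lemma line_inner_bound:
  assumes "g \<in> USp n" "i < n"
  shows "\<bar>line_inner v i g\<bar> \<le> sqrt ((cmod (v i))\<^sup>2 + (cmod (v (i + n)))\<^sup>2)"
proof (rule real_le_rsqrt)
  have "(line_inner v i g)\<^sup>2 \<le> ((cmod (v i))\<^sup>2 + (cmod (v (i + n)))\<^sup>2) * 1"
    by (rule order_trans[OF line_inner_square_le]) (intro mult_left_mono line_norm2_le_1 assms, simp)
  then show "\<bar>line_inner v i g\<bar>\<^sup>2 \<le> (cmod (v i))\<^sup>2 + (cmod (v (i + n)))\<^sup>2" by simp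
qed

lemma line_inner_mult_integrable:
  assumes "i < n" "j < n"
  shows "integrable M (\<lambda>g. line_inner v i g * line_inner v j g)"
proof (rule integrable_const_bound)
  show "AE g in M. norm (line_inner v i g * line_inner v j g) \<le>
      sqrt ((cmod (v i))\<^sup>2 + (cmod (v (i + n)))\<^sup>2) * sqrt ((cmod (v j))\<^sup>2 + (cmod (v (j + n)))\<^sup>2)"
    using assms by (intro AE_I2) (auto simp: space_M abs_mult intro!: mult_mono line_inner_bound)
qed (use assms in measurable)

text \<open>Changing the sign of the single coordinate line \<open>i\<close> is left multiplication by an element of the
  group. It preserves the integral and negates the integrand.\<close>

lemma line_inner_uncorrelated:
  assumes i: "i < n" and j: "j < n" and ij: "i \<noteq> j"
  shows "(\<integral>g. line_inner v i g * line_inner v j g \<partial>M) = 0"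
proof -
  interpret line_symmetry n "\<lambda>k. k" "\<lambda>k. if k = i then - 1 else 1"
    by unfold_locales auto
  have "line_inner v i (K * g) * line_inner v j (K * g) = - (line_inner v i g * line_inner v j g)"
    if "g \<in> USp n" for g
    using i j ij c unfolding line_inner_def
    by (simp add: K_mult_index[OF USp_carrier[OF that]] \<sigma>_def d_def algebra_simps del: index_mult_mat(1))
  then have "(\<integral>g. line_inner v i (K * g) * line_inner v j (K * g) \<partial>M)
      = (\<integral>g. - (line_inner v i g * line_inner v j g) \<partial>M)"
    by (intro Bochner_Integration.integral_cong) (auto simp: space_M)
  moreover have "(\<lambda>g. line_inner v i g * line_inner v j g) \<in> borel_measurable M"
    using i j by measurable
  ultimately show ?thesis
    using integral_left_involution[OF K_USp K_K, of "\<lambda>g. line_inner v i g * line_inner v j g"] by simp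
qed

text \<open>The real inner product of column \<open>c\<close> with \<open>v\<close> is a sum of uncorrelated contributions of the
  coordinate lines, and each of these is estimated by the Cauchy--Schwarz inequality.\<close>

lemma second_moment_le:
  shows "integrable M (\<lambda>g. (Re (col_herm n v c g))\<^sup>2)"
    and "(\<integral>g. (Re (col_herm n v c g))\<^sup>2 \<partial>M) \<le> Re (herm (2*n) v v) / n"
proof -
  have eq: "(Re (col_herm n v c g))\<^sup>2 = (\<Sum>i<n. \<Sum>j<n. line_inner v i g * line_inner v j g)" for g
    unfolding herm_def sum_two_blocks Re_sum line_inner_def[symmetric] power2_eq_square sum_product ..
  show "integrable M (\<lambda>g. (Re (col_herm n v c g))\<^sup>2)"
    unfolding eq by (intro Bochner_Integration.integrable_sum line_inner_mult_integrable) auto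
  have "(\<integral>g. (Re (col_herm n v c g))\<^sup>2 \<partial>M) =
      (\<Sum>i<n. \<Sum>j<n. \<integral>g. line_inner v i g * line_inner v j g \<partial>M)"
    unfolding eq
    by (subst Bochner_Integration.integral_sum)
      (auto intro!: line_inner_mult_integrable sum.cong Bochner_Integration.integral_sum)
  also have "\<dots> = (\<Sum>i<n. \<Sum>j<n. if j = i then \<integral>g. line_inner v i g * line_inner v i g \<partial>M else 0)"
    using line_inner_uncorrelated by (intro sum.cong refl) auto
  also have "\<dots> = (\<Sum>i<n. \<integral>g. (line_inner v i g)\<^sup>2 \<partial>M)"
    by (simp add: power2_eq_square)
  also have "\<dots> \<le> (\<Sum>i<n. \<integral>g. ((cmod (v i))\<^sup>2 + (cmod (v (i + n)))\<^sup>2) * line_norm2 i g \<partial>M)"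
    using line_inner_mult_integrable[of _ _ v] line_norm2_integrable
    by (intro sum_mono integral_mono line_inner_square_le) (auto simp: power2_eq_square)
  also have "\<dots> = Re (herm (2*n) v v) / n"
    unfolding herm_def sum_two_blocks
    by (simp add: integral_line_norm2 sum_divide_distrib[symmetric] sum.distrib complex_mult_cnj cmod_power2)
  finally show "(\<integral>g. (Re (col_herm n v c g))\<^sup>2 \<partial>M) \<le> Re (herm (2*n) v v) / n" .
qed

text \<open>The real part of the Hermitian product with \<open>\<i> v\<close> is the imaginary part of the
  Hermitian product with \<open>v\<close>.\<close>

lemma norm_moment_le:
  assumes v: "herm (2*n) v v = 1"
  shows "integrable M (\<lambda>g. (cmod (col_herm n v c g))\<^sup>2)"
    and "(\<integral>g. (cmod (col_herm n v c g))\<^sup>2 \<partial>M) \<le> 2 / n"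
proof -
  define iv where "iv k = \<i> * v k" for k
  have iv: "herm (2*n) iv iv = 1"
    using v by (simp add: herm_def iv_def algebra_simps)
  have "col_herm n iv c g = - \<i> * col_herm n v c g" for g
    by (simp add: herm_def iv_def sum_distrib_left algebra_simps sum_negf)
  then have eq: "(cmod (col_herm n v c g))\<^sup>2 = (Re (col_herm n v c g))\<^sup>2 + (Re (col_herm n iv c g))\<^sup>2" for g
    by (simp add: cmod_power2)
  show "integrable M (\<lambda>g. (cmod (col_herm n v c g))\<^sup>2)"
    unfolding eq by (intro Bochner_Integration.integrable_add second_moment_le)
  show "(\<integral>g. (cmod (col_herm n v c g))\<^sup>2 \<partial>M) \<le> 2 / n"
    using second_moment_le[of v] second_moment_le[of iv] v iv unfolding eq by simp
qed

end

text \<open>Columns \<open>0\<close> and \<open>n\<close> of \<open>g\<close> span the quaternionic line of the point \<open>g e\<^sub>1\<close> of the sphere, so the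
  tested quantity is the squared norm of the projection of \<open>v\<close> onto that line. Its mean is at most
  \<open>4 / n\<close>, and Markov's inequality applies.\<close>

lemma col_herm_tail:
  fixes t :: real
  assumes v: "herm (2*n) v v = 1" and t: "0 < t"
  shows "{g \<in> space M. t \<le> (cmod (col_herm n v 0 g))\<^sup>2 + (cmod (col_herm n v n g))\<^sup>2} \<in> sets M" (is "?B \<in> _")
    and "measure M {g \<in> space M. t \<le> (cmod (col_herm n v 0 g))\<^sup>2 + (cmod (col_herm n v n g))\<^sup>2} \<le> 4 / (n * t)"
proof -
  let ?F = "\<lambda>g. (cmod (col_herm n v 0 g))\<^sup>2 + (cmod (col_herm n v n g))\<^sup>2"
  note 0 = norm_moment_le[of 0, OF _ v] and n = norm_moment_le[of n, OF _ v]
  have F: "integrable M ?F"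
    using 0(1) n(1) n_pos by simp
  have int: "(\<integral>g. ?F g \<partial>M) \<le> 4 / n"
    using 0 n n_pos by simp
  show "?B \<in> sets M"
    using borel_measurable_integrable[OF F] by measurable
  have "measure M ?B \<le> (\<integral>g. ?F g \<partial>M) / t"
    by (rule integral_Markov_inequality_measure[OF F sets.empty_sets]) (use t in auto)
  also have "\<dots> \<le> (4 / n) / t"
    using int t by (intro divide_right_mono) auto
  finally show "measure M ?B \<le> 4 / (n * t)" by simp
qed

end

section \<open>Concentration near the preimage of an equator\<close>

text \<open>A normal vector of the equator is rescaled to unit length. The image of \<open>e\<^sub>1\<close> under a matrix is
  its first column, which lies on the sphere for every group element.\<close>

lemma equator_unit_normal:
  assumes n: "0 < n" and S: "is_equator n S"
  obtains v where "herm (2*n) v v = 1"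
    "\<And>g. g \<in> USp n \<Longrightarrow> Re (col_herm n v 0 g) = 0 \<Longrightarrow> g \<in> equator_preimage n S"
proof -
  obtain w where w: "w \<in> carrier_vec (2*n)" "w \<noteq> 0\<^sub>v (2*n)"
    and S_eq: "S = {x \<in> sphere_C n. Re (x \<bullet>c w) = 0}"
    using S by (auto simp: is_equator_def)
  define N where "N = (\<Sum>i<2*n. (cmod (w $ i))\<^sup>2)"
  have N: "N > 0"
  proof -
    obtain i where i: "i < 2*n" "w $ i \<noteq> 0"
      using w by (metis carrier_vecD eq_vecI index_zero_vec)
    then have "0 < (cmod (w $ i))\<^sup>2" by simp
    also have "\<dots> \<le> N"
      unfolding N_def using i member_le_sum[of i "{..<2*n}" "\<lambda>i. (cmod (w $ i))\<^sup>2"] by simp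
    finally show ?thesis .
  qed
  define v where "v i = w $ i / complex_of_real (sqrt N)" for i
  have prod: "x \<bullet>c w = complex_of_real (sqrt N) * herm (2*n) (\<lambda>i. x $ i) v"
    if "x \<in> carrier_vec (2*n)" for x
    using that w(1) N
    by (simp add: scalar_prod_def herm_def v_def sum_distrib_left lessThan_atLeast0 conjugate_vec_def)
  have sq: "complex_of_real (sqrt N) * complex_of_real (sqrt N) = complex_of_real N"
    using N by (simp flip: of_real_mult)
  have "v i * cnj (v i) = complex_of_real ((cmod (w $ i))\<^sup>2) / complex_of_real N" for i
    unfolding v_def complex_norm_square sq[symmetric] by simp
  then have "herm (2*n) v v = complex_of_real N / complex_of_real N"
    by (simp add: herm_def sum_divide_distrib[symmetric] N_def del: of_real_power)
  then have 1: "herm (2*n) v v = 1" using N by simp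
  have 2: "g \<in> equator_preimage n S" if g: "g \<in> USp n" and zero: "Re (col_herm n v 0 g) = 0" for g
  proof -
    note gc = USpD(1)[OF g]
    have col: "USp_proj n g = col g 0"
      unfolding USp_proj_def using gc n by (auto intro!: eq_vecI)
    have cc: "col g 0 \<in> carrier_vec (2*n)" using gc by (intro carrier_vecI) simp
    have idx: "col g 0 $ i = g $$ (i, 0)" if "i < 2*n" for i
      using that gc n by auto
    have "col g 0 \<bullet>c col g 0 = complex_of_real (\<Sum>i<2*n. (cmod (g $$ (i, 0)))\<^sup>2)"
      using cc gc n by (simp add: scalar_prod_def lessThan_atLeast0 conjugate_vec_def complex_norm_square idx
          del: of_real_power)
    then have "col g 0 \<in> sphere_C n"
      using USp_column_norm[OF g, of 0] n cc by (simp add: sphere_C_def)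
    moreover have "herm (2*n) (\<lambda>i. col g 0 $ i) v = col_herm n v 0 g"
      unfolding herm_def by (intro sum.cong refl) (simp add: idx)
    ultimately show ?thesis
      using g zero prod[OF cc] by (simp add: equator_preimage_def S_eq col)
  qed
  show thesis by (rule that[OF 1 2])
qed

text \<open>Outside the exceptional set of \<open>col_herm_tail\<close> the rotation of \<open>rotate_into_equator\<close> reaches the
  preimage of the equator on a path of length at most \<open>2 \<delta>\<close>; the factor \<open>3\<close> makes the strict
  inequality in the definition of a tubular neighbourhood hold.\<close>

lemma (in haar) equator_tube_complement:
  fixes \<delta> :: real
  assumes S: "is_equator n S" and \<delta>: "0 < \<delta>" "\<delta>\<^sup>2 \<le> 1/2"
  shows "measure M (USp n - tubular_nbhd n (equator_preimage n S) (3 * \<delta>)) \<le> 4 / (n * \<delta>\<^sup>2)"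
proof -
  obtain v where v: "herm (2*n) v v = 1"
    and pre: "\<And>g. g \<in> USp n \<Longrightarrow> Re (col_herm n v 0 g) = 0 \<Longrightarrow> g \<in> equator_preimage n S"
    using equator_unit_normal[OF n_pos S] by blast
  let ?F = "\<lambda>g. (cmod (col_herm n v 0 g))\<^sup>2 + (cmod (col_herm n v n g))\<^sup>2"
  let ?B = "{g \<in> space M. \<delta>\<^sup>2 \<le> ?F g}"
  let ?C = "USp n - tubular_nbhd n (equator_preimage n S) (3 * \<delta>)"
  note B = col_herm_tail[OF v zero_less_power[OF \<delta>(1), of 2]]
  have sub: "?C \<subseteq> ?B"
  proof
    fix g assume g: "g \<in> ?C"
    then have gU: "g \<in> USp n" by simp
    show "g \<in> ?B"
    proof (rule ccontr)
      assume "g \<notin> ?B"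
      then have F: "?F g < \<delta>\<^sup>2" using gU by (simp add: space_M)
      then have "?F g \<le> 1/2" using \<delta>(2) by linarith
      then obtain h where h: "h \<in> USp n" "Re (col_herm n v 0 h) = 0"
        and dist: "USp_dist n g h \<le> ennreal (2 * \<bar>Re (col_herm n v 0 g)\<bar>)"
        by (rule rotate_into_equator[OF n_pos gU v])
      have "(cmod (col_herm n v 0 g))\<^sup>2 \<le> \<delta>\<^sup>2"
        using F zero_le_power2[of "cmod (col_herm n v n g)"] by linarith
      then have "cmod (col_herm n v 0 g) \<le> \<delta>"
        using \<delta>(1) by (simp add: power2_le_iff_abs_le)
      then have "2 * \<bar>Re (col_herm n v 0 g)\<bar> < 3 * \<delta>"
        using abs_Re_le_cmod[of "col_herm n v 0 g"] \<delta>(1) by linarith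
      then have "USp_dist n g h < ennreal (3 * \<delta>)"
        by (intro le_less_trans[OF dist] ennreal_lessI) (use \<delta>(1) in simp_all)
      then have "(INF h \<in> equator_preimage n S. USp_dist n g h) < ennreal (3 * \<delta>)"
        by (rule le_less_trans[OF INF_lower[OF pre[OF h]]])
      then show False using g by (simp add: tubular_nbhd_def)
    qed
  qed
  have "measure M ?C \<le> measure M ?B"
  \<comment> \<open>A set outside the \<open>\<sigma>\<close>-algebra has measure \<open>0\<close> by convention; inside it, the measurable superset \<open>?B\<close> gives the bound.\<close>
  proof (cases "?C \<in> sets M")
    case True
    then show ?thesis using sub B(1) by (intro finite_measure_mono)
  qed (simp add: measure_notin_sets)
  then show ?thesis using B(2) by simp
qed

theorem proposition3:
  fixes \<mu> :: "nat \<Rightarrow> complex mat measure" and S :: "nat \<Rightarrow> complex Matrix.vec set"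
  assumes haar: "\<And>n. n \<ge> 2 \<Longrightarrow> is_haar_measure n (\<mu> n)"
    and equator: "\<And>n. n \<ge> 2 \<Longrightarrow> is_equator n (S n)"
  shows "\<exists>\<epsilon> :: nat \<Rightarrow> real. (\<forall>n\<ge>2. \<epsilon> n > 0) \<and> \<epsilon> \<longlonglongrightarrow> 0 \<and>
    (\<lambda>n. measure (\<mu> n) (USp n - tubular_nbhd n (equator_preimage n (S n)) (\<epsilon> n))) \<longlonglongrightarrow> 0"
proof (intro exI conjI allI impI)
  \<comment> \<open>Any positive sequence with \<open>\<delta> n \<longlonglongrightarrow> 0\<close> and \<open>n * (\<delta> n)\<^sup>2 \<longlonglongrightarrow> \<infinity>\<close> would do; for \<open>n ^ (- 1/4)\<close> the bound becomes \<open>4 / sqrt n\<close>.\<close>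
  define \<delta> where "\<delta> n = 1 / sqrt (sqrt (real n))" for n
  have sqrt_lim: "filterlim (\<lambda>n. sqrt (real n)) at_top sequentially"
    by (rule filterlim_compose[OF sqrt_at_top filterlim_real_sequentially])
  show "3 * \<delta> n > 0" if "n \<ge> 2" for n
    using that by (simp add: \<delta>_def)
  have "\<delta> \<longlonglongrightarrow> 0"
    unfolding \<delta>_def
    by (rule tendsto_divide_0[OF tendsto_const])
      (intro filterlim_at_top_imp_at_infinity filterlim_compose[OF sqrt_at_top sqrt_lim])
  then show "(\<lambda>n. 3 * \<delta> n) \<longlonglongrightarrow> 0"
    using tendsto_mult_right_zero by blast
  \<comment> \<open>From \<open>n = 4\<close> on, \<open>(\<delta> n)\<^sup>2 \<le> 1/2\<close>, as needed to rotate into the equator.\<close>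
  have bound: "measure (\<mu> n) (USp n - tubular_nbhd n (equator_preimage n (S n)) (3 * \<delta> n))
      \<le> 4 / sqrt (real n)" if n: "n \<ge> 4" for n
  proof -
    interpret haar n "\<mu> n" using n assms(1)[of n] by unfold_locales auto
    have \<delta>: "\<delta> n > 0" "(\<delta> n)\<^sup>2 = 1 / sqrt (real n)"
      using n by (simp_all add: \<delta>_def power_divide)
    have "sqrt (real n) \<ge> 2"
      using n by (intro real_le_rsqrt) simp
    then have "(\<delta> n)\<^sup>2 \<le> 1/2"
      unfolding \<delta>(2) by (intro frac_le) auto
    then have "measure (\<mu> n) (USp n - tubular_nbhd n (equator_preimage n (S n)) (3 * \<delta> n))
        \<le> 4 / (n * (\<delta> n)\<^sup>2)"
      using n by (intro equator_tube_complement equator \<delta>(1)) auto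
    also have "n * (\<delta> n)\<^sup>2 = sqrt (real n)"
      unfolding \<delta>(2) using n by (simp add: real_div_sqrt)
    finally show ?thesis .
  qed
  show "(\<lambda>n. measure (\<mu> n) (USp n - tubular_nbhd n (equator_preimage n (S n)) (3 * \<delta> n))) \<longlonglongrightarrow> 0"
  proof (rule tendsto_sandwich[OF _ _ tendsto_const])
    show "\<forall>\<^sub>F n in sequentially. 0 \<le> measure (\<mu> n) (USp n - tubular_nbhd n (equator_preimage n (S n)) (3 * \<delta> n))"
      by simp
    show "\<forall>\<^sub>F n in sequentially. measure (\<mu> n) (USp n - tubular_nbhd n (equator_preimage n (S n)) (3 * \<delta> n))
        \<le> 4 / sqrt (real n)"
      using bound by (auto simp: eventually_sequentially)
    show "(\<lambda>n. 4 / sqrt (real n)) \<longlonglongrightarrow> 0"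
      by (rule tendsto_divide_0[OF tendsto_const filterlim_at_top_imp_at_infinity[OF sqrt_lim]])
  qed
qed

end
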